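(* Let $P$ be a circular fence poset. Then the order polynomial $\Omega(P;t)$ has nonnegative coefficients.
   Context: A circular fence poset is obtained from a (connected) fence poset by adding a comparability relation between its first and last elements: it is a poset on elements $x_1,\dots,x_n$ ($n\ge 2$) whose partial order is the transitive closure of relations, one for each $i=1,\dots,n-1$, of the form $x_i\prec x_{i+1}$ or $x_i\succ x_{i+1}$, together with one further relation $x_1\prec x_n$ or $x_1\succ x_n$, where the choices are such that the relations contain no directed cycle (so that a partial order results). For a finite poset $P$, the order polynomial $\Omega(P;t)$ is the unique polynomial in $\mathbb{Q}[t]$ such that for every positive integer $t$, $\Omega(P;t)$ equals the number of maps $f:P\to\{1,\dots,t\}$ with $f(x)\le f(y)$ whenever $x\preceq y$. *)

theory Defs
  imports Complex_Main "HOL-Library.FuncSet" "HOL-Computational_Algebra.Polynomial"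
begin

text \<open>
  A poset is a carrier \<open>P\<close> with a reflexive order relation \<open>r\<close> (\<open>partial_order_on P r\<close>), where
  \<open>(a, b) \<in> r\<close> stands for \<open>a \<preceq> b\<close>.

  The Booleans record the choices of direction: \<open>up i\<close> says whether \<open>x i \<prec> x (i + 1)\<close> or
  \<open>x i \<succ> x (i + 1)\<close> for \<open>1 \<le> i < n\<close>, and \<open>c\<close> says whether \<open>x 1 \<prec> x n\<close> or \<open>x 1 \<succ> x n\<close>.
\<close>

definition circular_fence_relations ::
    "nat \<Rightarrow> (nat \<Rightarrow> 'a) \<Rightarrow> (nat \<Rightarrow> bool) \<Rightarrow> bool \<Rightarrow> ('a \<times> 'a) set" where
  "circular_fence_relations n x up c =
     (\<lambda>i. if up i then (x i, x (Suc i)) else (x (Suc i), x i)) ` {1..<n}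
     \<union> {if c then (x 1, x n) else (x n, x 1)}"

definition circular_fence_poset :: "'a set \<Rightarrow> ('a \<times> 'a) set \<Rightarrow> bool" where
  "circular_fence_poset P r \<longleftrightarrow>
     (\<exists>n x up c. n \<ge> 2 \<and> bij_betw x {1..n} P
        \<and> acyclic (circular_fence_relations n x up c)
        \<and> r = Id_on P \<union> (circular_fence_relations n x up c)\<^sup>+)"

definition order_preserving_maps :: "'a set \<Rightarrow> ('a \<times> 'a) set \<Rightarrow> nat \<Rightarrow> ('a \<Rightarrow> nat) set" where
  "order_preserving_maps P r t = {f \<in> P \<rightarrow>\<^sub>E {1..t}. \<forall>(a, b) \<in> r. f a \<le> f b}"

definition order_polynomial :: "'a set \<Rightarrow> ('a \<times> 'a) set \<Rightarrow> rat poly" where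
  "order_polynomial P r =
     (THE p. \<forall>t::nat. t > 0 \<longrightarrow> poly p (of_nat t) = of_nat (card (order_preserving_maps P r t)))"

lemma circular_fence_poset_finite: "circular_fence_poset P r \<Longrightarrow> finite P"
  unfolding circular_fence_poset_def using bij_betw_finite by blast

lemma circular_fence_poset_partial_order:
  assumes "circular_fence_poset P r"
  shows "partial_order_on P r"
proof -
  obtain n x up c where n: "n \<ge> 2" and x: "bij_betw x {1..n} P"
    and ac: "acyclic (circular_fence_relations n x up c)"
    and r: "r = Id_on P \<union> (circular_fence_relations n x up c)\<^sup>+"
    using assms unfolding circular_fence_poset_def by blast
  let ?R = "circular_fence_relations n x up c"
  have mem: "x i \<in> P" if "1 \<le> i" "i \<le> n" for i
    using x that by (auto simp: bij_betw_def)
  have "?R \<subseteq> P \<times> P"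
    using n by (auto simp: circular_fence_relations_def intro!: mem split: if_splits)
  then have sub: "?R\<^sup>+ \<subseteq> P \<times> P"
    by (rule trancl_subset_Sigma)
  have "trans r"
    unfolding r by (rule transI) (auto intro: trancl_trans)
  moreover have "antisym r"
    unfolding r using ac by (intro antisymI) (auto simp: acyclic_def dest: trancl_trans)
  moreover have "refl_on P r" "r \<subseteq> P \<times> P"
    unfolding r using sub by (auto simp: refl_on_def)
  ultimately show ?thesis
    by (auto simp: partial_order_on_def preorder_on_def)
qed

lemma order_polynomial_exists:
  assumes "finite P" and "r \<subseteq> P \<times> P"
  shows "\<exists>p :: rat poly. \<forall>t::nat. poly p (of_nat t) = of_nat (card (order_preserving_maps P r t))"
proof -
  define M where "M S = {f \<in> P \<rightarrow>\<^sub>E S. f ` P = S \<and> (\<forall>(a, b) \<in> r. f a \<le> f b)}" for S :: "nat set"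
  have finM: "finite (M S)" if "finite S" for S
    unfolding M_def using finite_PiE[of P "\<lambda>_. S"] assms that by simp
  have M_card: "card (M S) = card (M {..<card S})" if fS: "finite S" for S
  proof -
    obtain h where h: "bij_betw h {..<card S} S" "strict_mono_on {..<card S} h"
      using ex_bij_betw_strict_mono_card[OF fS] by blast
    have inj: "inj_on h {..<card S}" and im: "h ` {..<card S} = S"
      using h(1) by (auto simp: bij_betw_def)
    have hle: "h i \<le> h j \<longleftrightarrow> i \<le> j" if "i < card S" "j < card S" for i j
      using h(2) that by (simp add: strict_mono_on_less_eq)
    let ?g = "inv_into {..<card S} h"
    have g: "?g s < card S" "h (?g s) = s" if "s \<in> S" for s
      using that im inv_into_into[of s h "{..<card S}"] f_inv_into_f[of s h "{..<card S}"] by auto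
    have gh: "?g (h i) = i" if "i < card S" for i
      using inj that by simp
    have "bij_betw (\<lambda>f. restrict (h \<circ> f) P) (M {..<card S}) (M S)"
    proof (rule bij_betwI[where g = "\<lambda>f. restrict (?g \<circ> f) P"])
      show "(\<lambda>f. restrict (h \<circ> f) P) \<in> M {..<card S} \<rightarrow> M S"
      proof
        fix f assume f: "f \<in> M {..<card S}"
        then have fP: "f a < card S" if "a \<in> P" for a using that by (auto simp: M_def)
        have "f ` P = {..<card S}" using f by (simp add: M_def)
        then have im': "restrict (h \<circ> f) P ` P = S"
          using im by (metis image_comp image_restrict_eq)
        have "restrict (h \<circ> f) P a \<le> restrict (h \<circ> f) P b" if "(a, b) \<in> r" for a b
          using that f assms(2) by (auto simp: M_def hle fP)
        with im' show "restrict (h \<circ> f) P \<in> M S"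
          unfolding M_def by (auto simp del: restrict_apply)
      qed
      show "(\<lambda>f. restrict (?g \<circ> f) P) \<in> M S \<rightarrow> M {..<card S}"
      proof
        fix f assume f: "f \<in> M S"
        then have fP: "f a \<in> S" if "a \<in> P" for a using that by (auto simp: M_def)
        have "f ` P = S" using f by (simp add: M_def)
        moreover have "?g ` S = {..<card S}"
          using im inj by (metis inv_into_image_cancel subset_refl)
        ultimately have im': "restrict (?g \<circ> f) P ` P = {..<card S}"
          by (metis image_comp image_restrict_eq)
        have "restrict (?g \<circ> f) P a \<le> restrict (?g \<circ> f) P b" if ab: "(a, b) \<in> r" for a b
        proof -
          have "a \<in> P" "b \<in> P" "f a \<le> f b" using ab f assms(2) by (auto simp: M_def)
          then show ?thesis using hle[of "?g (f a)" "?g (f b)"] g fP by simp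
        qed
        with im' show "restrict (?g \<circ> f) P \<in> M {..<card S}"
          unfolding M_def by (auto simp del: restrict_apply)
      qed
      fix f assume f: "f \<in> M {..<card S}"
      show "restrict (?g \<circ> restrict (h \<circ> f) P) P = f"
        using f gh by (auto simp: M_def fun_eq_iff restrict_def PiE_def extensional_def Pi_def)
    next
      fix f assume f: "f \<in> M S"
      show "restrict (h \<circ> restrict (?g \<circ> f) P) P = f"
        using f g by (auto simp: M_def fun_eq_iff restrict_def PiE_def extensional_def Pi_def)
    qed
    then show ?thesis by (simp add: bij_betw_same_card)
  qed
  define m where "m k = card (M {..<k})" for k
  have m0: "m k = 0" if "k > card P" for k
  proof -
    have "M {..<k} = {}"
      unfolding M_def using that card_image_le[OF assms(1)] by (metis (mono_tags, lifting) Collect_empty_eq card_lessThan leD)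
    then show ?thesis by (simp add: m_def)
  qed
  have count: "card (order_preserving_maps P r t) = (\<Sum>k\<le>card P. (t choose k) * m k)" for t
  proof -
    have un: "order_preserving_maps P r t = (\<Union>S\<in>Pow {1..t}. M S)"
      unfolding order_preserving_maps_def M_def by (auto simp: PiE_def Pi_def)
    have "card (order_preserving_maps P r t) = (\<Sum>S\<in>Pow {1..t}. card (M S))"
      unfolding un
    proof (rule card_UN_disjoint)
      show "\<forall>S\<in>Pow {1..t}. finite (M S)"
        using finM finite_subset by blast
      show "\<forall>S\<in>Pow {1..t}. \<forall>S'\<in>Pow {1..t}. S \<noteq> S' \<longrightarrow> M S \<inter> M S' = {}"
        by (auto simp: M_def)
    qed simp
    also have "\<dots> = (\<Sum>S\<in>Pow {1..t}. m (card S))"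
      unfolding m_def by (rule sum.cong) (use M_card finite_subset in blast)+
    also have "\<dots> = (\<Sum>k\<le>t. \<Sum>S | S \<in> Pow {1..t} \<and> card S = k. m (card S))"
      by (rule sum.group[symmetric]) (auto dest: card_mono[OF finite_atLeastAtMost])
    also have "\<dots> = (\<Sum>k\<le>t. (t choose k) * m k)"
    proof (rule sum.cong)
      fix k
      have "(\<Sum>S | S \<in> Pow {1..t} \<and> card S = k. m (card S)) = card {S. S \<subseteq> {1..t} \<and> card S = k} * m k"
        by simp
      then show "(\<Sum>S | S \<in> Pow {1..t} \<and> card S = k. m (card S)) = (t choose k) * m k"
        using n_subsets[of "{1..t}" k] by simp
    qed simp
    also have "\<dots> = (\<Sum>k\<le>max t (card P). (t choose k) * m k)"
      by (rule sum.mono_neutral_left) auto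
    also have "\<dots> = (\<Sum>k\<le>card P. (t choose k) * m k)"
      by (rule sum.mono_neutral_right) (auto simp: m0)
    finally show ?thesis .
  qed
  define p :: "rat poly" where
    "p = (\<Sum>k\<le>card P. smult (of_nat (m k) / fact k) (\<Prod>i<k. [:- of_nat i, 1:]))"
  have "poly p (of_nat t) = of_nat (card (order_preserving_maps P r t))" for t
  proof -
    have "of_nat (t choose k) = (\<Prod>i<k. (of_nat t - of_nat i) :: rat) / fact k" for k
      by (simp add: binomial_gbinomial gbinomial_prod_rev atLeast0LessThan)
    then show ?thesis
      unfolding count p_def by (simp add: poly_sum poly_prod mult.commute)
  qed
  then show ?thesis by blast
qed

lemma order_polynomial_unique:
  fixes p q :: "rat poly"
  assumes "\<And>t::nat. t > 0 \<Longrightarrow> poly p (of_nat t) = poly q (of_nat t)"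
  shows "p = q"
proof (rule ccontr)
  assume "p \<noteq> q"
  then have "finite {x. poly (p - q) x = 0}"
    by (intro poly_roots_finite) simp
  moreover have "of_nat ` {0<..} \<subseteq> {x. poly (p - q) x = 0}"
    using assms by auto
  ultimately have "finite (of_nat ` {0<..} :: rat set)"
    by (rule rev_finite_subset)
  then have "finite {0::nat<..}"
    by (rule finite_imageD) simp
  then show False using infinite_Ioi by blast
qed

lemma poly_order_polynomial:
  assumes "finite P" and "r \<subseteq> P \<times> P" and "t > 0"
  shows "poly (order_polynomial P r) (of_nat t) = of_nat (card (order_preserving_maps P r t))"
proof -
  have "\<exists>!p :: rat poly. \<forall>t::nat. t > 0 \<longrightarrow>
      poly p (of_nat t) = of_nat (card (order_preserving_maps P r t))"
    using order_polynomial_exists[OF assms(1,2)] order_polynomial_unique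
    by (intro ex_ex1I) (blast, metis)
  from theI'[OF this] assms(3) show ?thesis
    unfolding order_polynomial_def by blast
qed

end

theory Submission
  imports Defs
begin

text \<open>
  Two reductions carry the proof.

  The first one reduces all coefficients to the linear ones. Splitting a map into
  \<open>{1..s + t}\<close> at the value \<open>s\<close> gives
  \<open>\<Omega>(V; s + t) = \<Sum>I. \<Omega>(I; s) * \<Omega>(V - I; t)\<close>, the sum being over the down-sets \<open>I\<close>. The part
  that is linear in \<open>s\<close> reads \<open>\<Omega>'(V; t) = \<Sum>I. L(I) * \<Omega>(V - I; t)\<close>, where \<open>L(I)\<close> is the linear
  coefficient of \<open>\<Omega>(I; t)\<close>. As \<open>L({}) = 0\<close>, only proper subsets \<open>V - I\<close> contribute, and induction
  on \<open>V\<close> shows that \<open>\<Omega>(V; t)\<close> has nonnegative coefficients as soon as \<open>L(W) \<ge> 0\<close> for all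
  \<open>W \<subseteq> V\<close> (\<open>nonneg_coeffs_if_nonneg_linear_coeffs\<close>).

  The second one computes the sign of \<open>L\<close> for a subset of a circular fence. Direct every edge
  along the cycle. Every vertex then has at most one outgoing and at most one incoming edge, and
  this is inherited by subsets. An edge \<open>(u, v)\<close> either points up (\<open>f u \<le> f v\<close>) or down
  (\<open>f v \<le> f u\<close>). A down edge is removed by inclusion and exclusion: the maps with \<open>f v \<le> f u\<close> are
  all maps without this condition, except those with \<open>f u < f v\<close>. So one has to allow strict
  edges as well, and with every strict edge comes a sign. The statement that survives the induction
  on the number of down edges is \<open>(-1) ^ b * L \<ge> 0\<close>, with \<open>b\<close> the number of strict edges
  (\<open>linear_coeff_oriented\<close>).

  When no down edge is left (\<open>linear_coeff_directed\<close>), the vertices form either a disconnected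
  graph, a directed cycle or a directed path. In the first case the polynomial is a product
  of two polynomials that vanish at \<open>0\<close>, so \<open>L = 0\<close>. In the second case the acyclicity of the
  weak edges forces a strict edge on the cycle, so no map exists. In the third case, with
  \<open>a\<close> weak edges and \<open>n = a + b + 1\<close> vertices, the number of maps is \<open>(t + a) choose n\<close>, whose
  linear coefficient is \<open>(-1) ^ b * a! * b! / n!\<close>.
\<close>

section \<open>Order-preserving maps for weak and strict relations\<close>

text \<open>
  Only pairs inside \<open>V \<times> V\<close> count, so that the same \<open>A\<close> and \<open>B\<close> serve all subsets of a vertex
  set, as the splitting over down-sets requires.
\<close>

definition mixed_maps :: "'a set \<Rightarrow> ('a \<times> 'a) set \<Rightarrow> ('a \<times> 'a) set \<Rightarrow> nat \<Rightarrow> ('a \<Rightarrow> nat) set" where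
  "mixed_maps V A B t = {f \<in> V \<rightarrow>\<^sub>E {1..t}.
     \<forall>a\<in>V. \<forall>b\<in>V. ((a, b) \<in> A \<longrightarrow> f a \<le> f b) \<and> ((a, b) \<in> B \<longrightarrow> f a < f b)}"

lemma finite_mixed_maps: "finite V \<Longrightarrow> finite (mixed_maps V A B t)"
  unfolding mixed_maps_def by (rule finite_subset[of _ "V \<rightarrow>\<^sub>E {1..t}"]) (auto intro: finite_PiE)

lemma mixed_maps_restrict:
  "mixed_maps V (A \<inter> V \<times> V) (B \<inter> V \<times> V) t = mixed_maps V A B t"
  unfolding mixed_maps_def by auto

lemma mixed_maps_empty_strict:
  assumes "r \<subseteq> V \<times> V"
  shows "mixed_maps V r {} t = order_preserving_maps V r t"
  unfolding mixed_maps_def order_preserving_maps_def using assms by fastforce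

text \<open>
  This allows the generating relations of a poset to stand for their transitive closure.
\<close>

lemma mixed_maps_mono_rtrancl:
  assumes f: "f \<in> mixed_maps V A B t" and sub: "A \<union> B \<subseteq> V \<times> V"
    and ab: "(a, b) \<in> (A \<union> B)\<^sup>*"
  shows "f a \<le> f b"
  using ab
proof induction
  case (step y z)
  then have "y \<in> V" "z \<in> V" using sub by auto
  then have "f y \<le> f z" using f step.hyps(2) by (auto simp: mixed_maps_def intro: less_imp_le)
  with step.IH show ?case by simp
qed simp

text \<open>
  For each map exactly one of \<open>f v \<le> f u\<close> and \<open>f u < f v\<close> holds.
\<close>

lemma card_mixed_maps_insert_weak:
  assumes "finite V" "u \<in> V" "v \<in> V"
  shows "card (mixed_maps V A B t) =
     card (mixed_maps V (insert (v, u) A) B t) + card (mixed_maps V A (insert (u, v) B) t)"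
proof -
  have "mixed_maps V A B t = mixed_maps V (insert (v, u) A) B t \<union> mixed_maps V A (insert (u, v) B) t"
    using assms by (auto simp: mixed_maps_def)
  moreover have "mixed_maps V (insert (v, u) A) B t \<inter> mixed_maps V A (insert (u, v) B) t = {}"
    using assms by (fastforce simp: mixed_maps_def)
  ultimately show ?thesis
    using finite_mixed_maps[OF assms(1)] by (simp add: card_Un_disjoint)
qed

section \<open>The counting polynomial\<close>

text \<open>
  The value at \<open>t = 0\<close> is prescribed too: the constant coefficient is then read off from the
  empty codomain.
\<close>

definition mixed_polynomial :: "'a set \<Rightarrow> ('a \<times> 'a) set \<Rightarrow> ('a \<times> 'a) set \<Rightarrow> rat poly" where
  "mixed_polynomial V A B =
     (THE p. \<forall>t::nat. poly p (of_nat t) = of_nat (card (mixed_maps V A B t)))"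

text \<open>
  Strict relations are traded one by one for weak ones by \<open>card_mixed_maps_insert_weak\<close>, until
  the count is that of an order polynomial.
\<close>

lemma mixed_polynomial_exists:
  assumes "finite V"
  shows "\<exists>p :: rat poly. \<forall>t::nat. poly p (of_nat t) = of_nat (card (mixed_maps V A B t))"
proof -
  have "finite (B \<inter> V \<times> V)" "B \<inter> V \<times> V \<subseteq> V \<times> V" using assms by auto
  then have "\<exists>p :: rat poly. \<forall>t::nat.
      poly p (of_nat t) = of_nat (card (mixed_maps V (A \<inter> V \<times> V) (B \<inter> V \<times> V) t))"
  proof (induction "B \<inter> V \<times> V" arbitrary: A B rule: finite_induct)
    case empty
    have "A \<inter> V \<times> V \<subseteq> V \<times> V" by blast
    from order_polynomial_exists[OF assms this] show ?case
      by (simp add: empty.hyps(1)[symmetric] mixed_maps_empty_strict)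
  next
    case (insert e F)
    obtain u v where e: "e = (u, v)" by fastforce
    have uv: "u \<in> V" "v \<in> V" and F: "F = F \<inter> V \<times> V" "F \<inter> V \<times> V \<subseteq> V \<times> V"
      using insert.hyps(4) e by auto
    have B: "mixed_maps V A B t = mixed_maps V A (insert (u, v) F) t" for t
      using mixed_maps_restrict[of V A B t] mixed_maps_restrict[of V A "insert (u, v) F" t]
        insert.hyps(4) e by (metis inf.left_idem inf_commute)
    obtain p q :: "rat poly" where
      p: "\<And>t::nat. poly p (of_nat t) = of_nat (card (mixed_maps V A F t))" and
      q: "\<And>t::nat. poly q (of_nat t) = of_nat (card (mixed_maps V (insert (v, u) A) F t))"
      using insert.hyps(3)[OF F, of A] insert.hyps(3)[OF F, of "insert (v, u) A"]
      unfolding mixed_maps_restrict by auto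
    have "poly (p - q) (of_nat t) = of_nat (card (mixed_maps V A B t))" for t :: nat
      by (simp add: p q B card_mixed_maps_insert_weak[OF assms uv, of A F t])
    then show ?case unfolding mixed_maps_restrict by blast
  qed
  then show ?thesis unfolding mixed_maps_restrict .
qed

lemma poly_mixed_polynomial:
  assumes "finite V"
  shows "poly (mixed_polynomial V A B) (of_nat t) = of_nat (card (mixed_maps V A B t))"
proof -
  have "\<exists>!p :: rat poly. \<forall>t::nat. poly p (of_nat t) = of_nat (card (mixed_maps V A B t))"
    using mixed_polynomial_exists[OF assms] order_polynomial_unique
    by (intro ex_ex1I) (blast, metis)
  from theI'[OF this] show ?thesis unfolding mixed_polynomial_def by blast
qed

lemma mixed_polynomial_eqI:
  assumes "finite V" "\<And>t::nat. t > 0 \<Longrightarrow> poly p (of_nat t) = of_nat (card (mixed_maps V A B t))"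
  shows "mixed_polynomial V A B = p"
  using assms by (intro order_polynomial_unique) (simp add: poly_mixed_polynomial)

lemma coeff_0_mixed_polynomial:
  assumes "finite V"
  shows "coeff (mixed_polynomial V A B) 0 = (if V = {} then 1 else 0)"
proof -
  have "mixed_maps V A B 0 = (if V = {} then {\<lambda>_. undefined} else {})"
    by (auto simp: mixed_maps_def PiE_def Pi_def)
  then show ?thesis
    using poly_mixed_polynomial[OF assms, of A B 0] by (simp add: poly_0_coeff_0)
qed

lemma mixed_polynomial_empty: "mixed_polynomial {} A B = 1"
  by (rule mixed_polynomial_eqI) (auto simp: mixed_maps_def)

lemma mixed_polynomial_cong:
  "A \<inter> V \<times> V = A' \<inter> V \<times> V \<Longrightarrow> B \<inter> V \<times> V = B' \<inter> V \<times> V \<Longrightarrow>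
    mixed_polynomial V A B = mixed_polynomial V A' B'"
  unfolding mixed_polynomial_def
  by (metis mixed_maps_restrict)

lemma mixed_polynomial_flip:
  assumes "finite V" "u \<in> V" "v \<in> V"
  shows "mixed_polynomial V (insert (v, u) A) B =
     mixed_polynomial V A B - mixed_polynomial V A (insert (u, v) B)"
  by (rule mixed_polynomial_eqI)
    (simp_all add: assms poly_mixed_polynomial card_mixed_maps_insert_weak[OF assms, of A B])

text \<open>
  Without a relation between \<open>V\<close> and \<open>W\<close>, the restrictions of a map to \<open>V\<close> and \<open>W\<close> can be
  chosen independently.
\<close>

lemma mixed_polynomial_disjoint_union:
  assumes fin: "finite V" "finite W" and disj: "V \<inter> W = {}"
    and sep: "(A \<union> B) \<inter> (V \<times> W \<union> W \<times> V) = {}"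
  shows "mixed_polynomial (V \<union> W) A B = mixed_polynomial V A B * mixed_polynomial W A B"
proof (rule mixed_polynomial_eqI)
  fix t :: nat
  have "bij_betw (\<lambda>f. (restrict f V, restrict f W)) (mixed_maps (V \<union> W) A B t)
      (mixed_maps V A B t \<times> mixed_maps W A B t)"
  proof (rule bij_betwI[where g = "\<lambda>(g, h). \<lambda>v\<in>V \<union> W. if v \<in> V then g v else h v"])
    show "(\<lambda>f. (restrict f V, restrict f W))
        \<in> mixed_maps (V \<union> W) A B t \<rightarrow> mixed_maps V A B t \<times> mixed_maps W A B t"
      by (auto simp: mixed_maps_def)
    show "(\<lambda>(g, h). \<lambda>v\<in>V \<union> W. if v \<in> V then g v else h v)
        \<in> mixed_maps V A B t \<times> mixed_maps W A B t \<rightarrow> mixed_maps (V \<union> W) A B t"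
    proof (clarify, goal_cases)
      case (1 g h)
      have g: "g v \<in> {1..t}" if "v \<in> V" for v using 1(1) that by (auto simp: mixed_maps_def)
      have h: "h v \<in> {1..t}" if "v \<in> W" for v using 1(2) that by (auto simp: mixed_maps_def)
      have "v \<notin> W" if "v \<in> V" for v using disj that by auto
      then show ?case using 1 g h sep unfolding mixed_maps_def
        by (simp add: PiE_iff) blast
    qed
  next
    fix f assume "f \<in> mixed_maps (V \<union> W) A B t"
    then have "f v = undefined" if "v \<notin> V \<union> W" for v
      using that by (auto simp: mixed_maps_def PiE_def extensional_def)
    then show "(case (restrict f V, restrict f W) of
        (g, h) \<Rightarrow> \<lambda>v\<in>V \<union> W. if v \<in> V then g v else h v) = f"
      by (auto simp: fun_eq_iff)
  next
    fix y assume "y \<in> mixed_maps V A B t \<times> mixed_maps W A B t"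
    then obtain g h where y: "y = (g, h)"
      and gh: "g \<in> extensional V" "h \<in> extensional W" by (auto simp: mixed_maps_def PiE_def)
    have "restrict (\<lambda>v\<in>V \<union> W. if v \<in> V then g v else h v) V = g"
      using gh(1) by (intro ext) (simp add: extensional_def)
    moreover have "restrict (\<lambda>v\<in>V \<union> W. if v \<in> V then g v else h v) W = h"
      using gh(2) disj by (intro ext) (auto simp: extensional_def)
    ultimately show "(\<lambda>f. (restrict f V, restrict f W))
       (case y of (g, h) \<Rightarrow> \<lambda>v\<in>V \<union> W. if v \<in> V then g v else h v) = y"
      by (simp add: y)
  qed
  from bij_betw_same_card[OF this]
  have "card (mixed_maps (V \<union> W) A B t) = card (mixed_maps V A B t) * card (mixed_maps W A B t)"
    by (simp only: card_cartesian_product)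
  then show "poly (mixed_polynomial V A B * mixed_polynomial W A B) (of_nat t)
      = of_nat (card (mixed_maps (V \<union> W) A B t))"
    by (simp add: fin poly_mixed_polynomial)
qed (use fin in auto)

text \<open>
  Both factors vanish at \<open>0\<close>, so their product vanishes there to second order.
\<close>

lemma linear_coeff_disconnected:
  assumes "finite V" "finite W" "V \<inter> W = {}" "(A \<union> B) \<inter> (V \<times> W \<union> W \<times> V) = {}"
    and "V \<noteq> {}" "W \<noteq> {}"
  shows "coeff (mixed_polynomial (V \<union> W) A B) 1 = 0"
  unfolding mixed_polynomial_disjoint_union[OF assms(1-4)]
  using assms by (simp add: coeff_mult coeff_0_mixed_polynomial atMost_Suc)

section \<open>Reduction to linear coefficients\<close>

definition down_sets :: "'a set \<Rightarrow> ('a \<times> 'a) set \<Rightarrow> 'a set set" where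
  "down_sets V A = {I. I \<subseteq> V \<and> (\<forall>a\<in>V. \<forall>b\<in>I. (a, b) \<in> A \<longrightarrow> a \<in> I)}"

lemma finite_down_sets: "finite V \<Longrightarrow> finite (down_sets V A)"
  by (rule finite_subset[of _ "Pow V"]) (auto simp: down_sets_def)

text \<open>
  The vertices with values at most \<open>s\<close> form a down-set. The values above \<open>s\<close> are shifted
  down by \<open>s\<close>, and relations that lead from the down-set to its complement hold for free.
\<close>

lemma card_mixed_maps_add:
  assumes "finite V"
  shows "card (mixed_maps V A {} (s + t)) =
    (\<Sum>I\<in>down_sets V A. card (mixed_maps I A {} s) * card (mixed_maps (V - I) A {} t))"
proof -
  let ?split = "\<lambda>f. let I = {v \<in> V. f v \<le> s} in (I, restrict f I, \<lambda>v\<in>V - I. f v - s)"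
  let ?join = "\<lambda>(I, g, h). \<lambda>v\<in>V. if v \<in> I then g v else h v + s"
  let ?T = "SIGMA I:down_sets V A. mixed_maps I A {} s \<times> mixed_maps (V - I) A {} t"
  have "bij_betw ?split (mixed_maps V A {} (s + t)) ?T"
  proof (rule bij_betwI[where g = ?join])
    show "?split \<in> mixed_maps V A {} (s + t) \<rightarrow> ?T"
    proof
      fix f assume f: "f \<in> mixed_maps V A {} (s + t)"
      then have rng: "f v \<in> {1..s + t}" if "v \<in> V" for v using that by (auto simp: mixed_maps_def)
      have mono: "f a \<le> f b" if "a \<in> V" "b \<in> V" "(a, b) \<in> A" for a b
        using f that by (auto simp: mixed_maps_def)
      have "f v - s \<in> {1..t}" if "v \<in> V" "\<not> f v \<le> s" for v
        using rng[OF that(1)] that(2) by auto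
      then show "?split f \<in> ?T"
        using rng by (auto simp: Let_def down_sets_def mixed_maps_def
            intro!: diff_le_mono mono dest: mono)
    qed
    show "?join \<in> ?T \<rightarrow> mixed_maps V A {} (s + t)"
    proof (clarify, goal_cases)
      case (1 I g h)
      have g: "g v \<in> {1..s}" if "v \<in> I" for v using 1 that by (auto simp: mixed_maps_def)
      have h: "h v \<in> {1..t}" if "v \<in> V" "v \<notin> I" for v using 1 that by (auto simp: mixed_maps_def)
      have ran: "(if v \<in> I then g v else h v + s) \<in> {1..s + t}" if "v \<in> V" for v
        using g[of v] h[of v] that by auto
      have mono: "(if a \<in> I then g a else h a + s) \<le> (if b \<in> I then g b else h b + s)"
        if "a \<in> V" "b \<in> V" "(a, b) \<in> A" for a b
        using g[of a] 1 that by (auto simp: mixed_maps_def down_sets_def)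
      show ?case using ran mono by (auto simp: mixed_maps_def simp del: atLeastAtMost_iff)
    qed
  next
    fix f assume "f \<in> mixed_maps V A {} (s + t)"
    then have "f \<in> extensional V" by (auto simp: mixed_maps_def PiE_def)
    then show "?join (?split f) = f"
      by (intro ext) (simp add: extensional_def Let_def)
  next
    fix y assume y: "y \<in> ?T"
    then obtain I g h where yy: "y = (I, g, h)" and I: "I \<in> down_sets V A"
      and g: "g \<in> mixed_maps I A {} s" and h: "h \<in> mixed_maps (V - I) A {} t" by auto
    have IV: "I \<subseteq> V" using I by (auto simp: down_sets_def)
    have gr: "g v \<le> s" if "v \<in> I" for v using g that by (auto simp: mixed_maps_def)
    have hr: "h v \<ge> 1" if "v \<in> V" "v \<notin> I" for v using h that by (auto simp: mixed_maps_def)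
    have ext: "g \<in> extensional I" "h \<in> extensional (V - I)"
      using g h by (auto simp: mixed_maps_def PiE_def)
    have "v \<in> V \<and> ?join y v \<le> s \<longleftrightarrow> v \<in> I" for v
      using gr[of v] hr[of v] IV by (auto simp: yy)
    then have eqI: "{v \<in> V. ?join y v \<le> s} = I" by blast
    have "restrict (?join y) I = g"
      using ext(1) IV by (intro HOL.ext) (auto simp: yy extensional_def)
    moreover have "(\<lambda>v\<in>V - I. ?join y v - s) = h"
      using ext(2) by (intro HOL.ext) (simp add: yy extensional_def)
    ultimately show "?split (?join y) = y"
      unfolding Let_def eqI by (simp add: yy)
  qed
  then have "card (mixed_maps V A {} (s + t)) = card ?T" by (rule bij_betw_same_card)
  also have "\<dots> = (\<Sum>I\<in>down_sets V A. card (mixed_maps I A {} s \<times> mixed_maps (V - I) A {} t))"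
    using assms by (intro card_SigmaI finite_down_sets ballI finite_cartesian_product finite_mixed_maps)
      (auto simp: down_sets_def intro: finite_subset)
  finally show ?thesis by (simp add: card_cartesian_product)
qed

text \<open>
  Both sides of \<open>card_mixed_maps_add\<close> are polynomials in \<open>s\<close> for fixed \<open>t\<close>, and the coefficient
  of \<open>s\<close> in \<open>p (s + t)\<close> is \<open>p' t\<close>.
\<close>

lemma pderiv_mixed_polynomial:
  assumes "finite V"
  shows "pderiv (mixed_polynomial V A {}) =
    (\<Sum>I\<in>down_sets V A. smult (coeff (mixed_polynomial I A {}) 1) (mixed_polynomial (V - I) A {}))"
proof (rule order_polynomial_unique)
  fix t :: nat
  let ?p = "\<lambda>W. mixed_polynomial W A {}"
  have fin: "finite I" if "I \<in> down_sets V A" for I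
    using that assms by (auto simp: down_sets_def intro: finite_subset)
  have "pcompose (?p V) [:of_nat t, 1:] =
      (\<Sum>I\<in>down_sets V A. smult (poly (?p (V - I)) (of_nat t)) (?p I))"
  proof (rule order_polynomial_unique)
    fix s :: nat
    have "poly (pcompose (?p V) [:of_nat t, 1:]) (of_nat s) = poly (?p V) (of_nat (s + t))"
      by (simp add: poly_pcompose add.commute)
    also have "\<dots> = (\<Sum>I\<in>down_sets V A. poly (?p I) (of_nat s) * poly (?p (V - I)) (of_nat t))"
      unfolding poly_mixed_polynomial[OF assms] card_mixed_maps_add[OF assms]
      by (simp add: poly_mixed_polynomial fin assms)
    finally show "poly (pcompose (?p V) [:of_nat t, 1:]) (of_nat s) =
        poly (\<Sum>I\<in>down_sets V A. smult (poly (?p (V - I)) (of_nat t)) (?p I)) (of_nat s)"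
      by (simp add: poly_sum mult.commute)
  qed
  then have "coeff (pcompose (?p V) [:of_nat t, 1:]) 1 =
      (\<Sum>I\<in>down_sets V A. poly (?p (V - I)) (of_nat t) * coeff (?p I) 1)"
    by (simp add: coeff_sum)
  moreover have "coeff (pcompose (?p V) [:of_nat t, 1:]) 1 = poly (pderiv (?p V)) (of_nat t)"
  proof -
    have "coeff (pcompose (?p V) [:of_nat t, 1:]) 1 =
        poly (pderiv (pcompose (?p V) [:of_nat t, 1:])) 0"
      by (simp add: poly_0_coeff_0 coeff_pderiv)
    also have "\<dots> = poly (pderiv (?p V)) (of_nat t)"
      by (simp add: pderiv_pcompose poly_pcompose pderiv_pCons)
    finally show ?thesis .
  qed
  ultimately show "poly (pderiv (?p V)) (of_nat t) = poly (\<Sum>I\<in>down_sets V A.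
      smult (coeff (?p I) 1) (?p (V - I))) (of_nat t)"
    by (simp add: poly_sum mult.commute)
qed

text \<open>
  In \<open>pderiv_mixed_polynomial\<close> the empty down-set has linear coefficient \<open>0\<close>; all others leave a
  proper subset of \<open>V\<close>, for which the claim is known by induction. The derivative determines all
  coefficients except the constant one, which is \<open>0\<close> or \<open>1\<close>.
\<close>

lemma nonneg_coeffs_if_nonneg_linear_coeffs:
  assumes "finite V" and "\<And>W. W \<subseteq> V \<Longrightarrow> coeff (mixed_polynomial W A {}) 1 \<ge> 0"
  shows "coeff (mixed_polynomial V A {}) k \<ge> 0"
  using assms
proof (induction V arbitrary: k rule: finite_psubset_induct)
  case (psubset V)
  let ?p = "\<lambda>W. mixed_polynomial W A {}"
  show ?case
  proof (cases k)
    case 0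
    then show ?thesis by (simp add: coeff_0_mixed_polynomial psubset.hyps)
  next
    case (Suc j)
    have "coeff (?p I) 1 * coeff (?p (V - I)) j \<ge> 0" if I: "I \<in> down_sets V A" for I
    proof (cases "I = {}")
      case True
      then show ?thesis by (simp add: mixed_polynomial_empty)
    next
      case False
      have "I \<subseteq> V" using I by (auto simp: down_sets_def)
      with False have "V - I \<subset> V" by auto
      then have "coeff (?p (V - I)) j \<ge> 0"
        by (rule psubset.IH) (use psubset.prems in auto)
      then show ?thesis using psubset.prems[OF \<open>I \<subseteq> V\<close>] by simp
    qed
    then have "coeff (pderiv (?p V)) j \<ge> 0"
      unfolding pderiv_mixed_polynomial[OF psubset.hyps]
      by (auto simp: coeff_sum intro!: sum_nonneg)
    then show ?thesis by (simp add: Suc coeff_pderiv zero_le_mult_iff)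
  qed
qed

section \<open>Directed paths\<close>

definition path_edges :: "'a list \<Rightarrow> ('a \<times> 'a) set" where
  "path_edges xs = set (zip xs (tl xs))"

lemma path_edges_subset: "path_edges xs \<subseteq> set xs \<times> set xs"
  unfolding path_edges_def by (cases xs) (auto dest: set_zip_leftD set_zip_rightD)

lemma path_edges_simps [simp]:
  "path_edges [] = {}" "path_edges [x] = {}"
  "path_edges (x # y # ys) = insert (x, y) (path_edges (y # ys))"
  by (auto simp: path_edges_def)

lemma path_edges_Cons: "xs \<noteq> [] \<Longrightarrow> path_edges (z # xs) = insert (z, hd xs) (path_edges xs)"
  by (cases xs) auto

lemma path_edges_snoc: "xs \<noteq> [] \<Longrightarrow> path_edges (xs @ [z]) = insert (last xs, z) (path_edges xs)"
proof (induction xs rule: induct_list012)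
  case (3 x y zs)
  then show ?case by auto
qed auto

lemma rtrancl_path_edges_last: "v \<in> set xs \<Longrightarrow> (v, last xs) \<in> (path_edges xs)\<^sup>*"
proof (induction xs arbitrary: v rule: induct_list012)
  case (3 x y zs)
  have mono: "(path_edges (y # zs))\<^sup>* \<subseteq> (path_edges (x # y # zs))\<^sup>*"
    by (intro rtrancl_mono) auto
  have tail: "(w, last (x # y # zs)) \<in> (path_edges (x # y # zs))\<^sup>*" if "w \<in> set (y # zs)" for w
    using 3(2)[of w] that mono by auto
  have "(x, y) \<in> path_edges (x # y # zs)" by simp
  then have "(x, last (x # y # zs)) \<in> (path_edges (x # y # zs))\<^sup>*"
    by (rule converse_rtrancl_into_rtrancl) (rule tail, simp)
  with tail 3(3) show ?case by auto
qed auto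

lemma rtrancl_path_edges_hd: "v \<in> set xs \<Longrightarrow> (hd xs, v) \<in> (path_edges xs)\<^sup>*"
proof (induction xs rule: induct_list012)
  case (3 x y zs)
  have "(path_edges (y # zs))\<^sup>* \<subseteq> (path_edges (x # y # zs))\<^sup>*"
    by (intro rtrancl_mono) auto
  with 3 show ?case by (auto intro: converse_rtrancl_into_rtrancl)
qed auto

lemma path_edges_leaving:
  "v \<in> set xs \<Longrightarrow> v \<noteq> last xs \<Longrightarrow> \<exists>w\<in>set xs. (v, w) \<in> path_edges xs"
  by (induction xs rule: induct_list012) (auto split: if_splits)

lemma path_edges_entering:
  "v \<in> set xs \<Longrightarrow> v \<noteq> hd xs \<Longrightarrow> \<exists>w\<in>set xs. (w, v) \<in> path_edges xs"
proof (induction xs rule: induct_list012)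
  case (3 x y zs)
  then show ?case by (cases "v = y") auto
qed auto

text \<open>
  Let \<open>l\<close> carry the largest value of every map on \<open>V\<close>, and put a new vertex \<open>z\<close> above \<open>l\<close>. If
  \<open>z\<close> has the value \<open>k\<close>, then the condition on \<open>l\<close> and \<open>z\<close> bounds all values on \<open>V\<close>, by \<open>k\<close>
  in the weak case and by \<open>k - 1\<close> in the strict case. So extending a chain means summing its counts.
\<close>

lemma card_mixed_maps_add_top:
  assumes fin: "finite V" and l: "l \<in> V" and z: "z \<notin> V" and sub: "A \<subseteq> V \<times> V" "B \<subseteq> V \<times> V"
    and top: "\<And>v. v \<in> V \<Longrightarrow> (v, l) \<in> (A \<union> B)\<^sup>*"
  shows "card (mixed_maps (insert z V) (insert (l, z) A) B t) = (\<Sum>k=1..t. card (mixed_maps V A B k))"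
    and "card (mixed_maps (insert z V) A (insert (l, z) B) t) = (\<Sum>k=1..t. card (mixed_maps V A B (k - 1)))"
proof -
  have le_top: "f v \<le> f l" if "f \<in> mixed_maps V A B k" "v \<in> V" for f v k
    using mixed_maps_mono_rtrancl[OF that(1) _ top[OF that(2)]] sub by auto
  \<comment> \<open>Both cases at once: \<open>h k\<close> is the bound that the value \<open>k\<close> of \<open>z\<close> imposes on \<open>V\<close>.\<close>
  have *: "card (mixed_maps (insert z V) A' B' t) = (\<Sum>k=1..t. card (mixed_maps V A B (h k)))"
    if A'B': "\<And>f. f \<in> mixed_maps (insert z V) A' B' t \<longleftrightarrow>
        f \<in> insert z V \<rightarrow>\<^sub>E {1..t} \<and> restrict f V \<in> mixed_maps V A B t \<and> f l \<le> h (f z)"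
      and h: "\<And>k. h k \<le> k" for A' B' h
  proof -
    have "bij_betw (\<lambda>f. (f z, restrict f V)) (mixed_maps (insert z V) A' B' t)
       (SIGMA k:{1..t}. mixed_maps V A B (h k))"
    proof (rule bij_betwI[where g = "\<lambda>(k, g). g(z := k)"])
      show "(\<lambda>f. (f z, restrict f V)) \<in> mixed_maps (insert z V) A' B' t \<rightarrow>
         (SIGMA k:{1..t}. mixed_maps V A B (h k))"
      proof
        fix f assume "f \<in> mixed_maps (insert z V) A' B' t"
        then have f: "f \<in> insert z V \<rightarrow>\<^sub>E {1..t}" "restrict f V \<in> mixed_maps V A B t" "f l \<le> h (f z)"
          using A'B' by auto
        have fv: "f v \<le> h (f z)" if "v \<in> V" for v
          using le_top[OF f(2) that] f(3) that l by simp
        have "restrict f V \<in> mixed_maps V A B (h (f z))"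
          using f(2) fv by (auto simp: mixed_maps_def)
        moreover have "f z \<in> {1..t}" using f(1) by auto
        ultimately show "(f z, restrict f V) \<in> (SIGMA k:{1..t}. mixed_maps V A B (h k))" by simp
      qed
      show "(\<lambda>(k, g). g(z := k)) \<in> (SIGMA k:{1..t}. mixed_maps V A B (h k)) \<rightarrow>
          mixed_maps (insert z V) A' B' t"
      proof (clarify, goal_cases)
        case (1 k g)
        have gk: "g v \<in> {1..h k}" if "v \<in> V" for v using 1(2) that by (auto simp: mixed_maps_def)
        have ht: "h k \<le> t" using h[of k] 1(1) by simp
        have gt: "g v \<in> {1..t}" if "v \<in> V" for v using gk[OF that] ht by simp
        have r: "restrict (g(z := k)) V = g"
          using 1(2) z by (auto simp: mixed_maps_def fun_eq_iff PiE_def extensional_def)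
        have "g \<in> mixed_maps V A B t" using 1(2) gt by (auto simp: mixed_maps_def PiE_iff)
        moreover have "g(z := k) \<in> insert z V \<rightarrow>\<^sub>E {1..t}"
          using 1 gt by (auto simp: mixed_maps_def PiE_def extensional_def)
        ultimately show ?case
          using A'B' r gk[OF l] l z by auto
      qed
    next
      fix f assume "f \<in> mixed_maps (insert z V) A' B' t"
      then have "f \<in> extensional (insert z V)" using A'B' by (auto simp: PiE_def)
      then show "(case (f z, restrict f V) of (k, g) \<Rightarrow> g(z := k)) = f"
        by (intro ext) (simp add: extensional_def)
    next
      fix y assume "y \<in> (SIGMA k:{1..t}. mixed_maps V A B (h k))"
      then obtain k g where y: "y = (k, g)" and "g \<in> extensional V"
        by (auto simp: mixed_maps_def PiE_def)
      then have "restrict (g(z := k)) V = g"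
        using z by (intro ext) (auto simp: extensional_def)
      then show "(\<lambda>f. (f z, restrict f V)) (case y of (k, g) \<Rightarrow> g(z := k)) = y"
        by (simp add: y)
    qed
    then have "card (mixed_maps (insert z V) A' B' t) = card (SIGMA k:{1..t}. mixed_maps V A B (h k))"
      by (rule bij_betw_same_card)
    then show ?thesis by (simp add: card_SigmaI finite_mixed_maps fin)
  qed
  have zAB: "(a, z) \<notin> A" "(z, a) \<notin> A" "(a, z) \<notin> B" "(z, a) \<notin> B" for a
    using z sub by auto
  show "card (mixed_maps (insert z V) (insert (l, z) A) B t) = (\<Sum>k=1..t. card (mixed_maps V A B k))"
  proof (rule *)
    fix f
    show "f \<in> mixed_maps (insert z V) (insert (l, z) A) B t \<longleftrightarrow>
        f \<in> insert z V \<rightarrow>\<^sub>E {1..t} \<and> restrict f V \<in> mixed_maps V A B t \<and> f l \<le> f z"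
      using z l zAB by (auto simp: mixed_maps_def)
  qed simp
  show "card (mixed_maps (insert z V) A (insert (l, z) B) t) = (\<Sum>k=1..t. card (mixed_maps V A B (k - 1)))"
  proof (rule *)
    fix f
    have "f l < f z \<longleftrightarrow> f l \<le> f z - 1" if "f \<in> insert z V \<rightarrow>\<^sub>E {1..t}"
    proof -
      have "f z \<ge> 1" using that by auto
      then show ?thesis by auto
    qed
    then show "f \<in> mixed_maps (insert z V) A (insert (l, z) B) t \<longleftrightarrow>
        f \<in> insert z V \<rightarrow>\<^sub>E {1..t} \<and> restrict f V \<in> mixed_maps V A B t \<and> f l \<le> f z - 1"
      using z l zAB by (auto simp: mixed_maps_def)
  qed simp
qed

text \<open>
  Raising each value by the number of weak steps before it makes all steps strict, so the
  maps correspond to the subsets of size \<open>length xs\<close> of \<open>{1..t + card A}\<close>. The proof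
  follows the recursion of \<open>card_mixed_maps_add_top\<close> instead, which is the hockey-stick identity for
  binomial coefficients. It starts from the value \<open>0\<close> at \<open>t = 0\<close> because a path has fewer edges
  than vertices.
\<close>

lemma card_mixed_maps_chain:
  assumes "xs \<noteq> []" "distinct xs" "A \<union> B = path_edges xs" "A \<inter> B = {}"
  shows "card A + card B = length xs - 1 \<and>
    card (mixed_maps (set xs) A B t) = (t + card A) choose (length xs)"
  using assms
proof (induction xs arbitrary: A B t rule: rev_induct)
  case (snoc z xs)
  show ?case
  proof (cases "xs = []")
    case True
    with snoc.prems have AB: "A = {}" "B = {}" by auto
    have "bij_betw (\<lambda>k. \<lambda>v\<in>{z}. k) {1..t} (mixed_maps {z} {} {} t)"
      by (rule bij_betwI[where g = "\<lambda>f. f z"])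
        (auto simp: mixed_maps_def fun_eq_iff PiE_def extensional_def)
    then have "card (mixed_maps {z} {} {} t) = t"
      by (metis bij_betw_same_card card_atLeastAtMost diff_Suc_1)
    then show ?thesis using True AB by simp
  next
    case False
    let ?e = "(last xs, z)" and ?n = "length xs"
    have z: "z \<notin> set xs" and dist: "distinct xs" using snoc.prems by auto
    have e: "?e \<notin> path_edges xs" using path_edges_subset[of xs] z by auto
    have AB: "A \<union> B = insert ?e (path_edges xs)"
      using snoc.prems path_edges_snoc[OF False] by simp
    have finAB: "finite A" "finite B"
      using AB by (metis finite_Un finite_insert path_edges_def finite_set)+
    have l: "last xs \<in> set xs" using False by simp
    have n: "?n \<ge> 1" using False by (cases xs) auto
    show ?thesis
    proof (cases "?e \<in> A")
      case True
      define A' where "A' = A - {?e}"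
      have A: "A = insert ?e A'" "?e \<notin> A'" using True by (auto simp: A'_def)
      have eB: "?e \<notin> A' \<union> B" and A'B2: "A' \<inter> B = {}" using A snoc.prems(4) by auto
      have "insert ?e (A' \<union> B) = insert ?e (path_edges xs)" using AB A(1) by simp
      then have A'B1: "A' \<union> B = path_edges xs" using eB e insert_ident by metis
      note A'B = A'B1 A'B2
      have sub: "A' \<subseteq> set xs \<times> set xs" "B \<subseteq> set xs \<times> set xs"
        using A'B path_edges_subset[of xs] by auto
      note IH = snoc.IH[OF False dist A'B]
      have cA: "card A = Suc (card A')" using A finAB by simp
      have "card (mixed_maps (set (xs @ [z])) A B t) = (\<Sum>k=1..t. (k + card A') choose ?n)"
        using card_mixed_maps_add_top(1)[OF _ l z sub, of t] rtrancl_path_edges_last[of _ xs] IH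
        by (simp add: A(1) A'B)
      also have "\<dots> = (t + card A) choose Suc ?n"
      proof (induction t)
        case 0
        have "card A < Suc ?n" using IH[THEN conjunct1] cA n by linarith
        then show ?case by (simp add: binomial_eq_0)
      next
        case (Suc t) then show ?case by (simp add: cA)
      qed
      finally show ?thesis using IH cA n by auto
    next
      case False
      define B' where "B' = B - {?e}"
      have B: "B = insert ?e B'" "?e \<notin> B'" using False AB by (auto simp: B'_def)
      have eA: "?e \<notin> A \<union> B'" and AB'2: "A \<inter> B' = {}" using B False snoc.prems(4) by auto
      have "insert ?e (A \<union> B') = insert ?e (path_edges xs)" using AB B(1) by simp
      then have AB'1: "A \<union> B' = path_edges xs" using eA e insert_ident by metis
      note AB' = AB'1 AB'2
      have sub: "A \<subseteq> set xs \<times> set xs" "B' \<subseteq> set xs \<times> set xs"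
        using AB' path_edges_subset[of xs] by auto
      note IH = snoc.IH[OF \<open>xs \<noteq> []\<close> dist AB']
      have cB: "card B = Suc (card B')" using B finAB by simp
      have "card (mixed_maps (set (xs @ [z])) A B t) = (\<Sum>k=1..t. (k - 1 + card A) choose ?n)"
        using card_mixed_maps_add_top(2)[OF _ l z sub, of t] rtrancl_path_edges_last[of _ xs] IH
        by (simp add: B(1) AB')
      also have "\<dots> = (t + card A) choose Suc ?n"
      proof (induction t)
        case 0
        have "card A < Suc ?n" using IH[THEN conjunct1] n by linarith
        then show ?case by (simp add: binomial_eq_0)
      next
        case (Suc t) then show ?case by simp
      qed
      finally show ?thesis using IH cB n by auto
    qed
  qed
qed simp

text \<open>
  With \<open>a = card A\<close>, the polynomial \<open>(t + a) choose n\<close> is \<open>1 / n!\<close> times the product of the factors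
  \<open>t + a - i\<close> for \<open>i < n\<close>. The factor for \<open>i = a\<close> is \<open>t\<close>, so the linear coefficient is the product
  of the numbers \<open>a - i\<close> for \<open>i \<noteq> a\<close>. There is one negative number among them for each of the
  \<open>n - 1 - a = card B\<close> indices \<open>i > a\<close>.
\<close>

lemma linear_coeff_chain:
  assumes "xs \<noteq> []" "distinct xs" "A \<union> B = path_edges xs" "A \<inter> B = {}"
  shows "(-1) ^ card B * coeff (mixed_polynomial (set xs) A B) 1 \<ge> 0"
proof -
  let ?n = "length xs" and ?a = "card A" and ?b = "card B"
  have n: "?a + ?b = ?n - 1" using card_mixed_maps_chain[OF assms] by blast
  have a: "?a < ?n" using n assms(1) by (cases xs) auto
  define q :: "rat poly" where "q = (\<Prod>i\<in>{..<?n} - {?a}. [:of_nat ?a - of_nat i, 1:])"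
  have "mixed_polynomial (set xs) A B = smult (1 / fact ?n) (pCons 0 q)"
  proof (rule mixed_polynomial_eqI)
    fix t :: nat
    have "poly (smult (1 / fact ?n) (pCons 0 q)) (of_nat t) =
        1 / fact ?n * (\<Prod>i<?n. of_nat t + of_nat ?a - of_nat i)"
      using a by (simp add: prod.remove[of "{..<?n}" ?a] q_def poly_prod algebra_simps)
    also have "\<dots> = of_nat ((t + ?a) choose ?n)"
      by (simp add: binomial_gbinomial gbinomial_prod_rev atLeast0LessThan)
    finally show "poly (smult (1 / fact ?n) (pCons 0 q)) (of_nat t) =
        of_nat (card (mixed_maps (set xs) A B t))"
      using card_mixed_maps_chain[OF assms] by simp
  qed simp
  then have "coeff (mixed_polynomial (set xs) A B) 1 = 1 / fact ?n * poly q 0"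
    by (simp add: poly_0_coeff_0)
  also have "poly q 0 = (\<Prod>i\<in>{..<?a} \<union> {?a<..<?n}. of_nat ?a - of_nat i)"
  proof -
    have "{..<?n} - {?a} = {..<?a} \<union> {?a<..<?n}" using a by auto
    then show ?thesis unfolding q_def by (simp add: poly_prod)
  qed
  also have "\<dots> = (\<Prod>i<?a. of_nat ?a - of_nat i) * (\<Prod>i\<in>{?a<..<?n}. of_nat ?a - of_nat i)"
    by (rule prod.union_disjoint) auto
  also have "(\<Prod>i\<in>{?a<..<?n}. of_nat ?a - of_nat i :: rat) =
      (-1) ^ ?b * (\<Prod>i\<in>{?a<..<?n}. of_nat i - of_nat ?a)"
  proof -
    have "card {?a<..<?n} = ?b" using n by simp
    then have "(-1) ^ ?b * (\<Prod>i\<in>{?a<..<?n}. of_nat i - of_nat ?a :: rat) =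
        (\<Prod>i\<in>{?a<..<?n}. (-1) * (of_nat i - of_nat ?a))"
      unfolding prod.distrib prod_constant by simp
    then show ?thesis by simp
  qed
  finally have "(-1) ^ ?b * coeff (mixed_polynomial (set xs) A B) 1 =
     1 / fact ?n * ((\<Prod>i<?a. of_nat ?a - of_nat i) * (\<Prod>i\<in>{?a<..<?n}. of_nat i - of_nat ?a))"
    by (simp add: power_mult_distrib[symmetric] flip: power_add mult_2)
  also have "\<dots> \<ge> 0"
    by (intro mult_nonneg_nonneg prod_nonneg) auto
  finally show ?thesis .
qed

section \<open>The sign of the linear coefficient\<close>

text \<open>
  The hypotheses on \<open>single_valued\<close> say that every vertex has at most one outgoing and at most one
  incoming edge, so that the components of the graph are directed paths and cycles. One component
  is found as the vertex set of a longest path. If it is not all of \<open>V\<close>, the graph is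
  disconnected; otherwise it is a path, or a cycle that runs through all of \<open>V\<close>.
\<close>

lemma linear_coeff_directed:
  assumes fin: "finite V" and sub: "U \<union> S \<subseteq> V \<times> V" and disj: "U \<inter> S = {}"
    and sv: "single_valued (U \<union> S)" and inj: "single_valued ((U \<union> S)\<inverse>)" and ac: "acyclic U"
  shows "(-1) ^ card S * coeff (mixed_polynomial V U S) 1 \<ge> 0"
proof (cases "V = {}")
  case True
  then show ?thesis by (simp add: mixed_polynomial_empty)
next
  case False
  let ?R = "U \<union> S"
  let ?P = "\<lambda>xs. xs \<noteq> [] \<and> distinct xs \<and> set xs \<subseteq> V \<and> path_edges xs \<subseteq> ?R"
  obtain v where "v \<in> V" using False by blast
  then have "?P [v]" by simp
  moreover have "\<forall>xs. ?P xs \<longrightarrow> length xs < Suc (card V)"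
    using fin by (metis card_mono distinct_card less_Suc_eq_le)
  ultimately obtain xs where xs: "?P xs" and max: "\<And>ys. ?P ys \<Longrightarrow> length ys \<le> length xs"
    using ex_has_greatest_nat[of ?P "[v]" length "Suc (card V)"] by blast
  \<comment> \<open>By maximality no edge leaves or enters the path, and the only edge between its vertices
      apart from the path edges is one that closes it to a cycle.\<close>
  have out: "b \<in> set xs \<and> ((a, b) \<in> path_edges xs \<or> a = last xs \<and> b = hd xs)"
    if ab: "(a, b) \<in> ?R" "a \<in> set xs" for a b
  proof (cases "a = last xs")
    case True
    have "b \<in> V" using ab sub by blast
    have b: "b \<in> set xs"
    proof (rule ccontr)
      assume "b \<notin> set xs"
      then have "?P (xs @ [b])" using xs True ab \<open>b \<in> V\<close> by (simp add: path_edges_snoc)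
      from max[OF this] show False by simp
    qed
    show ?thesis
    proof (cases "b = hd xs")
      case False
      then obtain w where "(w, b) \<in> path_edges xs" using path_edges_entering[OF b] by blast
      moreover from this have "w = a" using xs ab inj by (auto simp: single_valued_def)
      ultimately show ?thesis using b by blast
    qed (use True b in blast)
  next
    case False
    then obtain w where w: "w \<in> set xs" "(a, w) \<in> path_edges xs" using path_edges_leaving ab by metis
    moreover from this have "w = b" using xs ab sv by (auto simp: single_valued_def)
    ultimately show ?thesis by blast
  qed
  have into: "a \<in> set xs" if ab: "(a, b) \<in> ?R" "b \<in> set xs" for a b
  proof (cases "b = hd xs")
    case True
    have "a \<in> V" using ab sub by blast
    show ?thesis
    proof (rule ccontr)
      assume "a \<notin> set xs"
      then have "?P (a # xs)" using xs True ab \<open>a \<in> V\<close> by (simp add: path_edges_Cons)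
      from max[OF this] show False by simp
    qed
  next
    case False
    then obtain w where w: "w \<in> set xs" "(w, b) \<in> path_edges xs" using path_edges_entering ab by metis
    moreover from this have "w = a" using xs ab inj by (auto simp: single_valued_def)
    ultimately show ?thesis by blast
  qed
  show ?thesis
  proof (cases "set xs = V")
    case False
    then have "V - set xs \<noteq> {}" using xs by auto
    moreover have "?R \<inter> (set xs \<times> (V - set xs) \<union> (V - set xs) \<times> set xs) = {}"
      using out into by blast
    ultimately have "coeff (mixed_polynomial (set xs \<union> (V - set xs)) U S) 1 = 0"
      using xs fin by (intro linear_coeff_disconnected) auto
    moreover have "set xs \<union> (V - set xs) = V" using xs by auto
    ultimately show ?thesis by simp
  next
    case V: True
    show ?thesis
    proof (cases "(last xs, hd xs) \<in> ?R")
      case False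
      then have "?R = path_edges xs" using out xs sub V by blast
      then show ?thesis using linear_coeff_chain[of xs U S] xs disj V by auto
    next
      case True
      have conn: "(a, b) \<in> ?R\<^sup>*" if "a \<in> V" "b \<in> V" for a b
      proof -
        have "(path_edges xs)\<^sup>* \<subseteq> ?R\<^sup>*" using xs by (intro rtrancl_mono) auto
        then show ?thesis
          using that V True rtrancl_path_edges_last[of a xs] rtrancl_path_edges_hd[of b xs]
          by (meson converse_rtrancl_into_rtrancl rtrancl_trans subsetD)
      qed
      \<comment> \<open>On a cycle, values cannot decrease along any edge and hence are constant, which a strict
          edge contradicts.\<close>
      have "S \<noteq> {}"
      proof
        assume "S = {}"
        then have "(last xs, hd xs) \<in> U" "(hd xs, last xs) \<in> U\<^sup>*" using True conn xs V by auto
        then show False using ac by (meson acyclic_def rtrancl_into_trancl2)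
      qed
      then obtain u w where uw: "(u, w) \<in> S" by auto
      have "mixed_maps V U S t = {}" for t
      proof (rule equals0I)
        fix f assume f: "f \<in> mixed_maps V U S t"
        have "u \<in> V" "w \<in> V" using uw sub by auto
        then have "f w \<le> f u" using mixed_maps_mono_rtrancl[OF f sub conn] by blast
        moreover have "f u < f w" using f uw \<open>u \<in> V\<close> \<open>w \<in> V\<close> by (auto simp: mixed_maps_def)
        ultimately show False by simp
      qed
      then have "mixed_polynomial V U S = 0" by (intro mixed_polynomial_eqI fin) auto
      then show ?thesis by simp
    qed
  qed
qed

text \<open>
  Here \<open>U\<close>, \<open>D\<close> and \<open>S\<close> are the up, down and strict edges, all directed along the paths and cycles.
  Removing a down edge \<open>d\<close> expresses \<open>L\<close> as the linear coefficient without \<open>d\<close>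
  minus the one where \<open>d\<close> is strict. The number of strict edges increases by one in the latter, so
  the sign compensates for the minus, and both contributions are nonnegative.
\<close>

lemma linear_coeff_oriented:
  assumes "finite D" "finite S" "finite V" and "U \<union> D \<union> S \<subseteq> V \<times> V"
    and "U \<inter> D = {}" "U \<inter> S = {}" "D \<inter> S = {}"
    and "single_valued (U \<union> D \<union> S)" "single_valued ((U \<union> D \<union> S)\<inverse>)" and "acyclic U"
  shows "(-1) ^ card S * coeff (mixed_polynomial V (U \<union> D\<inverse>) S) 1 \<ge> 0"
  using assms
proof (induction D arbitrary: S rule: finite_induct)
  case empty
  then show ?case using linear_coeff_directed[of V U S] by simp
next
  case (insert d D)
  obtain u v where d: "d = (u, v)" by fastforce
  have uv: "u \<in> V" "v \<in> V" "d \<notin> S" using insert.prems d by auto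
  have eq: "U \<union> (insert d D)\<inverse> = insert (v, u) (U \<union> D\<inverse>)" using d by auto
  have "(-1) ^ card S * coeff (mixed_polynomial V (U \<union> D\<inverse>) S) 1 \<ge> 0"
    using insert.prems by (intro insert.IH) (auto simp: single_valued_def)
  moreover have "(-1) ^ card (insert d S) * coeff (mixed_polynomial V (U \<union> D\<inverse>) (insert d S)) 1 \<ge> 0"
    using insert.prems insert.hyps by (intro insert.IH) auto
  ultimately show ?case
    unfolding eq mixed_polynomial_flip[OF \<open>finite V\<close> uv(1,2)]
    using uv insert.prems d by (simp add: algebra_simps)
qed

section \<open>Circular fences\<close>

theorem theorem1p6:
  fixes P :: "'a set" and r :: "('a \<times> 'a) set"
  assumes "circular_fence_poset P r"
  shows "\<forall>k. coeff (order_polynomial P r) k \<ge> 0"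
proof
  fix k
  obtain n x up c where n: "n \<ge> 2" and x: "bij_betw x {1..n} P"
    and ac: "acyclic (circular_fence_relations n x up c)"
    and r: "r = Id_on P \<union> (circular_fence_relations n x up c)\<^sup>+"
    using assms unfolding circular_fence_poset_def by blast
  let ?R = "circular_fence_relations n x up c"
  have fin: "finite P" using assms by (rule circular_fence_poset_finite)
  \<comment> \<open>The edge number \<open>n\<close> closes the cycle from \<open>x n\<close> to \<open>x 1\<close>. It is traversed from \<open>x n\<close>, so it
      points up when the relation is \<open>x n \<prec> x 1\<close>, that is, when \<open>c\<close> is false. For \<open>n = 2\<close> the two
      edges are opposite pairs, hence still distinct.\<close>
  define next_index where "next_index i = (if i < n then Suc i else 1)" for i
  define edge where "edge i = (x i, x (next_index i))" for i
  define upward where "upward i \<longleftrightarrow> (if i < n then up i else \<not> c)" for i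
  define U where "U = edge ` {i \<in> {1..n}. upward i}"
  define D where "D = edge ` {i \<in> {1..n}. \<not> upward i}"
  have xP: "x i \<in> P" if "i \<in> {1..n}" for i using x that by (rule bij_betwE[THEN bspec])
  have x_eq: "x i = x j \<longleftrightarrow> i = j" if "i \<in> {1..n}" "j \<in> {1..n}" for i j
    using x that by (metis bij_betw_imp_inj_on inj_on_eq_iff)
  have next_mem: "next_index i \<in> {1..n}" if "i \<in> {1..n}" for i
    using that n by (auto simp: next_index_def)
  have next_eq: "next_index i = next_index j \<longleftrightarrow> i = j" if "i \<in> {1..n}" "j \<in> {1..n}" for i j
    using that by (auto simp: next_index_def)
  have R: "?R = U \<union> D\<inverse>"
  proof -
    have "{1..n} = insert n {1..<n}" using n by auto
    then have "U \<union> D\<inverse> = (\<lambda>i. if upward i then edge i else prod.swap (edge i)) ` (insert n {1..<n})"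
      unfolding U_def D_def by (auto simp: image_iff edge_def)
    also have "\<dots> = ?R"
      by (auto simp: circular_fence_relations_def edge_def upward_def next_index_def image_iff)
    finally show ?thesis by simp
  qed
  have sub: "U \<union> D \<subseteq> P \<times> P"
    unfolding U_def D_def edge_def using xP next_mem by auto
  have disj: "U \<inter> D = {}"
    unfolding U_def D_def edge_def using x_eq by auto
  have UD: "U \<union> D = edge ` {1..n}" unfolding U_def D_def by auto
  have sv: "single_valued (U \<union> D)"
    unfolding UD single_valued_def edge_def using x_eq by auto
  have inj: "single_valued ((U \<union> D)\<inverse>)"
    unfolding UD single_valued_def edge_def using x_eq next_eq next_mem by auto
  have acU: "acyclic U" using ac unfolding R by (rule acyclic_subset) auto
  \<comment> \<open>All hypotheses on the edges are inherited by their restrictions to \<open>W\<close>.\<close>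
  have linear: "coeff (mixed_polynomial W ?R {}) 1 \<ge> 0" if "W \<subseteq> P" for W
  proof -
    let ?U = "U \<inter> W \<times> W" and ?D = "D \<inter> W \<times> W"
    have finW: "finite W" using that fin by (rule finite_subset)
    have "(-1) ^ card ({} :: ('a \<times> 'a) set) * coeff (mixed_polynomial W (?U \<union> ?D\<inverse>) {}) 1 \<ge> 0"
    proof (rule linear_coeff_oriented)
      show "single_valued (?U \<union> ?D \<union> {})" by (rule single_valued_subset[OF _ sv]) auto
      show "single_valued ((?U \<union> ?D \<union> {})\<inverse>)" by (rule single_valued_subset[OF _ inj]) auto
      show "acyclic ?U" by (rule acyclic_subset[OF acU]) auto
    qed (use finW disj in auto)
    moreover have "mixed_polynomial W (?U \<union> ?D\<inverse>) {} = mixed_polynomial W ?R {}"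
      unfolding R by (rule mixed_polynomial_cong) auto
    ultimately show ?thesis by simp
  qed
  have subR: "?R \<subseteq> P \<times> P" unfolding R using sub by auto
  have rP: "r \<subseteq> P \<times> P"
    unfolding r using trancl_subset_Sigma[OF subR] by auto
  have "mixed_maps P r {} t = mixed_maps P ?R {} t" for t
  proof
    show "mixed_maps P r {} t \<subseteq> mixed_maps P ?R {} t"
      unfolding r mixed_maps_def by (auto dest: r_into_trancl)
    show "mixed_maps P ?R {} t \<subseteq> mixed_maps P r {} t"
    proof
      fix f assume f: "f \<in> mixed_maps P ?R {} t"
      have "f a \<le> f b" if "(a, b) \<in> r" for a b
        using that mixed_maps_mono_rtrancl[OF f, of a b] subR
        unfolding r by (auto dest: trancl_into_rtrancl)
      then show "f \<in> mixed_maps P r {} t" using f by (auto simp: mixed_maps_def)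
    qed
  qed
  then have "order_polynomial P r = mixed_polynomial P ?R {}"
    using poly_order_polynomial[OF fin rP] poly_mixed_polynomial[OF fin, of ?R "{}"]
    by (intro order_polynomial_unique) (simp flip: mixed_maps_empty_strict[OF rP])
  then show "coeff (order_polynomial P r) k \<ge> 0"
    using nonneg_coeffs_if_nonneg_linear_coeffs[OF fin linear] by simp
qed

end
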